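(* Let $q_\infty=0.5845751\dots$ be the unique positive root of the polynomial $Q_\infty(x)=x^4+x^3+2x^2-1$. Then each number $q\in(q_\infty,1)$ is approximating.
   Context: A balanced $\pm$-polynomial is a polynomial $P(x)$ of the form $\sum_{i=1}^n \pm x^i$ with $n\ge 1$ (each coefficient of $x^1,\dots,x^n$ is $+1$ or $-1$, and the constant term is $0$) such that $P(1)=0$; its degree is $n$. A number $q\in(1/2,1)$ is approximating if there exist non-negative numbers $A$ and $N$ such that for each $x_0\in[0,A]$ there exists a balanced $\pm$-polynomial $P$ of degree $n\le N$ such that $|x_0-P(q)|\le Aq^n$. *)

theory Defs
  imports Complex_Main "HOL-Computational_Algebra.Polynomial"
begin

definition balanced_pm_poly :: "real poly \<Rightarrow> bool" where
  "balanced_pm_poly P \<longleftrightarrow>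
     degree P \<ge> 1 \<and> coeff P 0 = 0 \<and>
     (\<forall>i\<in>{1..degree P}. coeff P i \<in> {1, -1}) \<and>
     poly P 1 = 0"

definition approximating :: "real \<Rightarrow> bool" where
  "approximating q \<longleftrightarrow>
     1/2 < q \<and> q < 1 \<and>
     (\<exists>A N :: real. A \<ge> 0 \<and> N \<ge> 0 \<and>
        (\<forall>x0\<in>{0..A}. \<exists>P. balanced_pm_poly P \<and> real (degree P) \<le> N \<and>
           \<bar>x0 - poly P q\<bar> \<le> A * q ^ degree P))"

definition Q_infinity :: "real poly" where
  "Q_infinity = [:-1, 0, 2, 1, 1:]"

(* The description is meaningful only if the positive root exists and is unique. *)
definition q_infinity :: real where
  "q_infinity = (THE x. x > 0 \<and> poly Q_infinity x = 0)"

end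

theory Submission imports Defs begin

text \<open>
  For \<open>j \<ge> 0\<close> consider the sign word \<open>+ (+ -)\<^sup>j -\<close>, of length \<open>2j+2\<close>. It is balanced, and
  the value \<open>c\<^sub>j\<close> of its polynomial at \<open>q\<close> increases with \<open>j\<close> to the value \<open>q(1+2q)/(1+q)\<close> of the
  infinite word \<open>+ + - + - \<dots>\<close>. Writing \<open>x0\<close> as \<open>P(q)\<close> up to an error \<open>A q\<^sup>n\<close> with one of these
  words means that the intervals with centres \<open>c\<^sub>j\<close> and radii \<open>A q^(2j+2)\<close> cover \<open>[0, A]\<close>.

  Consecutive centres differ by \<open>(1-q)(2+q) q^(2j+2)\<close>, whereas consecutive radii add up to
  \<open>A (1+q\<^sup>2) q^(2j+2)\<close>. With \<open>A = (1-q)(2+q)/(1+q\<^sup>2)\<close>, consecutive intervals therefore touch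
  exactly, for every \<open>j\<close> at once. The first interval reaches down to \<open>0\<close> because
  \<open>q \<ge> 1/2\<close>. Finitely many intervals reach up to \<open>A\<close> as soon as \<open>A\<close> is smaller than the limit
  of the centres, and this inequality unfolds to \<open>q^4 + q^3 + 2q\<^sup>2 - 1 > 0\<close>, that is,
  to \<open>q > q_infinity\<close>. As \<open>q\<close> decreases to \<open>q_infinity\<close> this gap between \<open>A\<close> and the limit closes,
  so the number of words used tends to infinity.
\<close>

text \<open>
  The tail \<open>(+ -)\<^sup>j -\<close> of the word is built from the front, so that degree, signs, and values all
  follow by induction from a constant number of new coefficients.
\<close>

fun alternating_tail :: "nat \<Rightarrow> real poly" where
  "alternating_tail 0 = [:-1:]"
| "alternating_tail (Suc j) = pCons 1 (pCons (-1) (alternating_tail j))"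

definition alternating_word :: "nat \<Rightarrow> real poly" where
  "alternating_word j = pCons 0 (pCons 1 (alternating_tail j))"

lemma alternating_tail_nonzero [simp]: "alternating_tail j \<noteq> 0"
  by (cases j) auto

lemma degree_alternating_tail: "degree (alternating_tail j) = 2 * j"
  by (induction j) auto

lemma degree_alternating_word: "degree (alternating_word j) = 2 * j + 2"
  by (simp add: alternating_word_def degree_alternating_tail)

lemma coeff_alternating_tail:
  "i \<le> 2 * j \<Longrightarrow> coeff (alternating_tail j) i \<in> {1, -1}"
proof (induction j arbitrary: i)
  case 0
  then show ?case by simp
next
  case (Suc j)
  show ?case
  proof (cases "i < 2")
    case True
    then have "i = 0 \<or> i = 1" by auto
    then show ?thesis by auto
  next
    case False
    then obtain k where "i = Suc (Suc k)"
      by (metis add_2_eq_Suc le_Suc_ex not_less)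
    then show ?thesis using Suc by simp
  qed
qed

lemma poly_alternating_tail_one: "poly (alternating_tail j) 1 = -1"
  by (induction j) auto

lemma balanced_alternating_word: "balanced_pm_poly (alternating_word j)"
proof -
  have "coeff (alternating_word j) i \<in> {1, -1}" if "i \<in> {1..2 * j + 2}" for i
  proof (cases "i = 1")
    case True
    then show ?thesis by (simp add: alternating_word_def)
  next
    case False
    with that obtain k where "i = Suc (Suc k)" "k \<le> 2 * j"
      by (cases i; cases "i - 1") auto
    then show ?thesis
      using coeff_alternating_tail[of k j] by (simp add: alternating_word_def)
  qed
  then show ?thesis
    unfolding balanced_pm_poly_def degree_alternating_word
    by (auto simp: alternating_word_def poly_alternating_tail_one)
qed

lemma poly_alternating_tail:
  "(1 + q) * poly (alternating_tail j) q = 1 - (2 + q) * q ^ (2 * j)"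
proof (induction j)
  case (Suc j)
  have "(1 + q) * poly (alternating_tail (Suc j)) q
      = (1 + q) * (1 - q) + q\<^sup>2 * ((1 + q) * poly (alternating_tail j) q)"
    by (simp add: algebra_simps power2_eq_square)
  also have "\<dots> = 1 - (2 + q) * q ^ (2 * Suc j)"
    unfolding Suc by (simp add: algebra_simps power2_eq_square)
  finally show ?case .
qed simp

text \<open>
  The first summand is the value of the infinite word; the second is the distance that
  remains after truncation, which decays at the same rate as the permitted error.
\<close>

lemma poly_alternating_word:
  assumes "q > 0"
  shows "poly (alternating_word j) q
       = q * (1 + 2 * q) / (1 + q) - (2 + q) / (1 + q) * q ^ (2 * j + 2)"
proof -
  have "(1 + q) * poly (alternating_word j) q
      = (1 + q) * q + q\<^sup>2 * ((1 + q) * poly (alternating_tail j) q)"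
    by (simp add: alternating_word_def algebra_simps power2_eq_square)
  also have "\<dots> = q * (1 + 2 * q) - (2 + q) * q ^ (2 * j + 2)"
    unfolding poly_alternating_tail by (simp add: algebra_simps power2_eq_square)
  finally have "poly (alternating_word j) q
      = (q * (1 + 2 * q) - (2 + q) * q ^ (2 * j + 2)) / (1 + q)"
    using assms by (simp add: field_simps)
  then show ?thesis
    by (simp add: diff_divide_distrib)
qed

lemma poly_alternating_tail_Suc:
  "poly (alternating_tail (Suc j)) q
     = poly (alternating_tail j) q + (1 - q) * (2 + q) * q ^ (2 * j)"
proof (induction j)
  case 0
  then show ?case
    by (simp add: algebra_simps)
next
  case (Suc j)
  have rec: "poly (alternating_tail (Suc i)) q = 1 - q + q\<^sup>2 * poly (alternating_tail i) q" for i
    by (simp add: algebra_simps power2_eq_square)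
  have "poly (alternating_tail (Suc (Suc j))) q
      = (1 - q + q\<^sup>2 * poly (alternating_tail j) q) + q\<^sup>2 * ((1 - q) * (2 + q) * q ^ (2 * j))"
    unfolding rec[of "Suc j"] Suc by (simp add: distrib_left)
  then show ?case
    by (simp only: rec[of j]) (simp add: power2_eq_square mult_ac)
qed

lemma poly_alternating_word_Suc:
  "poly (alternating_word (Suc j)) q
     = poly (alternating_word j) q + (1 - q) * (2 + q) * q ^ (2 * j + 2)"
proof -
  have "poly (alternating_word i) q = q + q\<^sup>2 * poly (alternating_tail i) q" for i
    by (simp add: alternating_word_def algebra_simps power2_eq_square)
  then show ?thesis
    by (simp only: poly_alternating_tail_Suc) (simp add: algebra_simps power2_eq_square)
qed

lemma poly_alternating_word_tendsto:
  assumes "0 < q" "q < 1"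
  shows "(\<lambda>j. poly (alternating_word j) q) \<longlonglongrightarrow> q * (1 + 2 * q) / (1 + q)"
proof -
  have "(\<lambda>j. (q\<^sup>2) ^ j) \<longlonglongrightarrow> 0"
    using assms by (intro LIMSEQ_realpow_zero) (auto simp: abs_square_less_1)
  then have "(\<lambda>j. q * (1 + 2 * q) / (1 + q) - (2 + q) / (1 + q) * ((q\<^sup>2) ^ j * q\<^sup>2))
      \<longlonglongrightarrow> q * (1 + 2 * q) / (1 + q) - (2 + q) / (1 + q) * (0 * q\<^sup>2)"
    by (intro tendsto_diff tendsto_mult tendsto_const)
  then show ?thesis
    by (simp only: poly_alternating_word[OF assms(1)] power_add power_mult
        mult_zero_left mult_zero_right diff_zero)
qed

text \<open>
  If each interval of a finite chain starts no later than its predecessor ends, a point between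
  the two extremes of the chain lies in the first interval whose right end reaches it.
\<close>

lemma covered_by_interval_chain:
  fixes l u :: "nat \<Rightarrow> 'a::linorder"
  assumes "l 0 \<le> x" "x \<le> u k" and chain: "\<And>j. l (Suc j) \<le> u j"
  obtains j where "j \<le> k" "l j \<le> x" "x \<le> u j"
proof -
  define j where "j = (LEAST j. x \<le> u j)"
  have "x \<le> u j"
    unfolding j_def using assms(2) by (rule LeastI)
  moreover have "j \<le> k"
    unfolding j_def using assms(2) by (rule Least_le)
  moreover have "l j \<le> x"
  proof (cases j)
    case 0
    then show ?thesis using assms(1) by simp
  next
    case (Suc i)
    then have "\<not> x \<le> u i"
      using not_less_Least[of i "\<lambda>j. x \<le> u j"] by (simp add: j_def)
    then show ?thesis using chain[of i] Suc by simp
  qed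
  ultimately show ?thesis using that by blast
qed

lemma approximating_if_Q_infinity_pos:
  assumes q: "1/2 < q" "q < 1" and Q: "poly Q_infinity q > 0"
  shows "approximating q"
proof -
  define A where "A = (1 - q) * (2 + q) / (1 + q\<^sup>2)"
  define c where "c j = poly (alternating_word j) q" for j
  define r where "r j = A * q ^ (2 * j + 2)" for j
  have den: "1 + q\<^sup>2 > 0"
    by (simp add: add_pos_nonneg)
  have A0: "A \<ge> 0"
    using q unfolding A_def by (intro divide_nonneg_pos mult_nonneg_nonneg den) auto
  have AD: "A * (1 + q\<^sup>2) = (1 - q) * (2 + q)"
    using den by (simp add: A_def)
  have touch: "c (Suc j) - r (Suc j) = c j + r j" for j
  proof -
    have "r j + r (Suc j) = A * (1 + q\<^sup>2) * q ^ (2 * j + 2)"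
      by (simp add: r_def algebra_simps power2_eq_square)
    then show ?thesis
      by (simp add: AD c_def poly_alternating_word_Suc)
  qed
  have first: "c 0 - r 0 \<le> 0"
  proof -
    have "(1 - q) * (1 + q\<^sup>2) \<le> (1 - q) * ((2 + q) * q)"
      using q by (intro mult_left_mono) (auto simp: algebra_simps power2_eq_square)
    then have "1 - q \<le> A * q"
      unfolding A_def using den by (simp add: field_simps)
    then have "q * (1 - q) \<le> q * (A * q)"
      using q by (intro mult_left_mono) auto
    then show ?thesis
      by (simp add: c_def r_def alternating_word_def algebra_simps power2_eq_square)
  qed
  have "A < q * (1 + 2 * q) / (1 + q)"
  proof -
    \<comment> \<open>After clearing denominators, the difference of the two sides is \<open>2 * Q_infinity(q)\<close>.\<close>
    have "q * (1 + 2 * q) * (1 + q\<^sup>2) - (1 - q) * (2 + q) * (1 + q) = 2 * poly Q_infinity q"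
      by (simp add: Q_infinity_def algebra_simps power2_eq_square)
    with Q have "(1 - q) * (2 + q) * (1 + q) < q * (1 + 2 * q) * (1 + q\<^sup>2)"
      by linarith
    then show ?thesis
      unfolding A_def using den q by (simp add: divide_less_eq less_divide_eq)
  qed
  then have "\<forall>\<^sub>F j in sequentially. A < c j"
    unfolding c_def using q by (intro order_tendstoD(1)[OF poly_alternating_word_tendsto]) auto
  then obtain k where k: "A < c k"
    by (auto dest: eventually_happens)
  have "\<exists>P. balanced_pm_poly P \<and> real (degree P) \<le> real (2 * k + 2) \<and>
      \<bar>x0 - poly P q\<bar> \<le> A * q ^ degree P" if x0: "x0 \<in> {0..A}" for x0
  proof -
    have "r k \<ge> 0"
      using A0 q by (simp add: r_def)
    then obtain j where "j \<le> k" "c j - r j \<le> x0" "x0 \<le> c j + r j"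
      using covered_by_interval_chain[of "\<lambda>j. c j - r j" x0 "\<lambda>j. c j + r j" k] first k x0 touch
      by force
    then show ?thesis
      using balanced_alternating_word
      by (intro exI[of _ "alternating_word j"])
        (auto simp: degree_alternating_word c_def r_def abs_le_iff)
  qed
  then show ?thesis
    unfolding approximating_def using q A0
    by (intro conjI exI[of _ A] exI[of _ "real (2 * k + 2)"]) auto
qed

lemma poly_Q_infinity: "poly Q_infinity x = x ^ 4 + x ^ 3 + 2 * x\<^sup>2 - 1"
  by (simp add: Q_infinity_def algebra_simps power_numeral_reduce)

lemma poly_Q_infinity_strict_mono:
  assumes "0 \<le> x" "x < y"
  shows "poly Q_infinity x < poly Q_infinity y"
  using power_strict_mono[OF assms(2,1), of 4] power_strict_mono[OF assms(2,1), of 3]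
    power_strict_mono[OF assms(2,1), of 2]
  by (simp add: poly_Q_infinity)

lemma Q_infinity_unique_root:
  obtains z where "0.5845751 \<le> z" "z < 0.5845752" "poly Q_infinity z = 0"
    "\<And>x. x > 0 \<Longrightarrow> poly Q_infinity x = 0 \<Longrightarrow> x = z"
proof -
  have lo: "poly Q_infinity 0.5845751 < 0" and hi: "poly Q_infinity 0.5845752 > 0"
    by (simp_all add: Q_infinity_def)
  obtain z where z: "0.5845751 < z" "z < 0.5845752" "poly Q_infinity z = 0"
    using poly_IVT_pos[OF _ lo hi] by auto
  moreover have "x = z" if "x > 0" "poly Q_infinity x = 0" for x
    using poly_Q_infinity_strict_mono[of x z] poly_Q_infinity_strict_mono[of z x] that z
    by (cases x z rule: linorder_cases) auto
  ultimately show ?thesis using that[of z] by (meson less_imp_le)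
qed

theorem proposition7:
  "(\<exists>!x. x > 0 \<and> poly Q_infinity x = 0) \<and>
   0.5845751 \<le> q_infinity \<and> q_infinity < 0.5845752 \<and>
   (\<forall>q\<in>{q_infinity<..<1}. approximating q)"
proof -
  obtain z where z: "0.5845751 \<le> z" "z < 0.5845752" "poly Q_infinity z = 0"
    and uniq: "\<And>x. x > 0 \<Longrightarrow> poly Q_infinity x = 0 \<Longrightarrow> x = z"
    by (rule Q_infinity_unique_root) blast
  then have ex1: "\<exists>!x. x > 0 \<and> poly Q_infinity x = 0"
    by (intro ex1I[of _ z]) auto
  have eq: "q_infinity = z"
    unfolding q_infinity_def using z uniq by (intro the_equality) auto
  have "approximating q" if "q \<in> {z<..<1}" for q
    using that z poly_Q_infinity_strict_mono[of z q]
    by (intro approximating_if_Q_infinity_pos) auto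
  then show ?thesis
    using ex1 z by (simp add: eq)
qed

end
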